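(* Let $\mathbf P=(P,\le,{}',0,1)$ be a bounded orthogonal saturated poset. Then (A1) is equivalent to each of the following conditions: (i) $\operatorname{Min}U(x,y')=y'\vee\big(\operatorname{Min}U(x,y')\wedge y\big)$ for all $x,y\in P$; (ii) $\operatorname{Min}U(x,y')\le_2 y'\vee\big(\operatorname{Min}U(x,y')\wedge y\big)$ for all $x,y\in P$; (iii) for all $x,y\in P$, $x'\le y$ implies $y=x'\vee(y\wedge x)$. Moreover, (A2) is equivalent to each of the following conditions: (iv) $x\wedge\big(\operatorname{Max}L(x,y)\vee x'\big)=\operatorname{Max}L(x,y)$ for all $x,y\in P$; (v) $x\wedge\big(\operatorname{Max}L(x,y)\vee x'\big)\le_1\operatorname{Max}L(x,y)$ for all $x,y\in P$; (vi) for all $x,y\in P$, $x\le y$ implies $x=(y'\vee x)\wedge y$.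
   Context: A bounded poset $(P,\le,0,1)$ has least element $0$ and greatest element $1$; $'$ is an arbitrary unary operation on $P$. For $x,y\in P$, $L(x,y)$ and $U(x,y)$ denote the sets of all common lower bounds, respectively common upper bounds, of $x$ and $y$; $\operatorname{Max}A$ and $\operatorname{Min}A$ denote the sets of maximal, respectively minimal, elements of $A\subseteq P$. $x\vee y$ and $x\wedge y$ denote supremum and infimum in $P$ and are said to be defined if they exist. For $A\subseteq P$ and $b\in P$, $A\vee b=b\vee A:=\{a\vee b\mid a\in A\}$ and $A\wedge b=b\wedge A:=\{a\wedge b\mid a\in A\}$. The poset is saturated if for all $x,y\in P$: every element of $L(x,y)$ lies below some element of $\operatorname{Max}L(x,y)$, and every element of $U(x,y)$ lies above some element of $\operatorname{Min}U(x,y)$. $(P,\le,{}')$ is orthogonal if for all $a,b\in P$: if $a\le b$ then $a\vee b'$ is defined; and if $a'\le b$ then $a\wedge b$ is defined. (In a bounded orthogonal saturated poset all joins and meets occurring in the claim and in the definitions below exist.) The generalized Sasaki operations assign to $x,y\in P$ the subsets $x\odot y:=\operatorname{Min}U(x,y')\wedge y$ and $x\to y:=x'\vee\operatorname{Max}L(x,y)$ of $P$. For $A,B\subseteq P$: $A\le_1B$ means that for every $a\in A$ there is $b\in B$ with $a\le b$; $A\le_2B$ means that for every $b\in B$ there is $a\in A$ with $a\le b$. Singletons are identified with their unique element. Consider the conditions (A1) for all $x,y,z\in P$, $x\odot y\le_2 z$ implies $x\le_1 y\to z$; (A2) for all $x,y,z\in P$, $x\le_1 y\to z$ implies $x\odot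 y\le_2 z$. *)

theory Defs
  imports Main
begin

definition L :: "'a::order \<Rightarrow> 'a \<Rightarrow> 'a set" where
  "L x y = {z. z \<le> x \<and> z \<le> y}"

definition U :: "'a::order \<Rightarrow> 'a \<Rightarrow> 'a set" where
  "U x y = {z. x \<le> z \<and> y \<le> z}"

definition Maximals :: "'a::order set \<Rightarrow> 'a set" where
  "Maximals A = {m \<in> A. \<forall>a\<in>A. m \<le> a \<longrightarrow> a = m}"

definition Minimals :: "'a::order set \<Rightarrow> 'a set" where
  "Minimals A = {m \<in> A. \<forall>a\<in>A. a \<le> m \<longrightarrow> a = m}"

definition join_defined :: "'a::order \<Rightarrow> 'a \<Rightarrow> bool" where
  "join_defined x y \<longleftrightarrow> (\<exists>s\<in>U x y. \<forall>t\<in>U x y. s \<le> t)"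

definition meet_defined :: "'a::order \<Rightarrow> 'a \<Rightarrow> bool" where
  "meet_defined x y \<longleftrightarrow> (\<exists>s\<in>L x y. \<forall>t\<in>L x y. t \<le> s)"

text \<open>The following two total functions are the supremum and the infimum only where these exist,
  and unspecified elsewhere. In the posets considered here they are only ever applied where they
  are defined, see lemmas \<open>defined_above\<close> and \<open>defined_below\<close>.\<close>

definition join :: "'a::order \<Rightarrow> 'a \<Rightarrow> 'a" (infixl "\<squnion>" 65) where
  "x \<squnion> y = (LEAST s. s \<in> U x y)"

definition meet :: "'a::order \<Rightarrow> 'a \<Rightarrow> 'a" (infixl "\<sqinter>" 70) where
  "x \<sqinter> y = (GREATEST s. s \<in> L x y)"

text \<open>\<open>b \<or> A\<close> and \<open>b \<and> A\<close> are by convention the same sets as \<open>A \<or> b\<close> and \<open>A \<and> b\<close>, and are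
  written in the latter order throughout.\<close>

definition set_join :: "'a::order set \<Rightarrow> 'a \<Rightarrow> 'a set" (infixl "\<squnion>\<^sub>S" 65) where
  "A \<squnion>\<^sub>S b = {a \<squnion> b | a. a \<in> A}"

definition set_meet :: "'a::order set \<Rightarrow> 'a \<Rightarrow> 'a set" (infixl "\<sqinter>\<^sub>S" 70) where
  "A \<sqinter>\<^sub>S b = {a \<sqinter> b | a. a \<in> A}"

definition le1 :: "'a::order set \<Rightarrow> 'a set \<Rightarrow> bool" (infix "\<le>\<^sub>1" 50) where
  "A \<le>\<^sub>1 B \<longleftrightarrow> (\<forall>a\<in>A. \<exists>b\<in>B. a \<le> b)"

definition le2 :: "'a::order set \<Rightarrow> 'a set \<Rightarrow> bool" (infix "\<le>\<^sub>2" 50) where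
  "A \<le>\<^sub>2 B \<longleftrightarrow> (\<forall>b\<in>B. \<exists>a\<in>A. a \<le> b)"

text \<open>\<open>c\<close> is the unary operation \<open>'\<close>; nothing (such as being antitone or an involution) is
  assumed about it beyond orthogonality.\<close>

locale bounded_orthogonal_saturated_poset =
  fixes c :: "'a::{order_bot, order_top} \<Rightarrow> 'a"
  assumes orthogonal_join: "a \<le> b \<Longrightarrow> join_defined a (c b)"
    and orthogonal_meet: "c a \<le> b \<Longrightarrow> meet_defined a b"
    and saturated_L: "(z::'a) \<in> L x y \<Longrightarrow> \<exists>m\<in>Maximals (L x y). z \<le> m"
    and saturated_U: "(z::'a) \<in> U x y \<Longrightarrow> \<exists>m\<in>Minimals (U x y). m \<le> z"

definition sasaki_odot :: "('a::order \<Rightarrow> 'a) \<Rightarrow> 'a \<Rightarrow> 'a \<Rightarrow> 'a set" where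
  "sasaki_odot c x y = Minimals (U x (c y)) \<sqinter>\<^sub>S y"

definition sasaki_imp :: "('a::order \<Rightarrow> 'a) \<Rightarrow> 'a \<Rightarrow> 'a \<Rightarrow> 'a set" where
  "sasaki_imp c x y = Maximals (L x y) \<squnion>\<^sub>S c x"

definition A1 :: "('a::order \<Rightarrow> 'a) \<Rightarrow> bool" where
  "A1 c \<longleftrightarrow> (\<forall>x y z. sasaki_odot c x y \<le>\<^sub>2 {z} \<longrightarrow> {x} \<le>\<^sub>1 sasaki_imp c y z)"

definition A2 :: "('a::order \<Rightarrow> 'a) \<Rightarrow> bool" where
  "A2 c \<longleftrightarrow> (\<forall>x y z. {x} \<le>\<^sub>1 sasaki_imp c y z \<longrightarrow> sasaki_odot c x y \<le>\<^sub>2 {z})"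

lemma join_commute: "x \<squnion> y = y \<squnion> x"
  by (simp add: join_def U_def conj_commute)

lemma meet_commute: "x \<sqinter> y = y \<sqinter> x"
  by (simp add: meet_def L_def conj_commute)

lemma join_in_U: "join_defined x y \<Longrightarrow> x \<squnion> y \<in> U x y"
  unfolding join_defined_def join_def by (metis Least_equality)

lemma meet_in_L: "meet_defined x y \<Longrightarrow> x \<sqinter> y \<in> L x y"
  unfolding meet_defined_def meet_def by (metis Greatest_equality)

context bounded_orthogonal_saturated_poset
begin

text \<open>The next two lemmas apply to \<open>m \<in> Minimals (U x (c y))\<close> and \<open>m \<in> Maximals (L y x)\<close>,
  respectively.\<close>

lemma defined_above:
  assumes "c y \<le> m"
  shows "meet_defined m y" and "join_defined (m \<sqinter> y) (c y)"
proof -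
  have "meet_defined y m"
    using assms by (rule orthogonal_meet)
  then show *: "meet_defined m y"
    by (auto simp: meet_defined_def L_def)
  show "join_defined (m \<sqinter> y) (c y)"
    using meet_in_L[OF *] by (auto simp: L_def intro: orthogonal_join)
qed

lemma defined_below:
  assumes "m \<le> y"
  shows "join_defined m (c y)" and "meet_defined (m \<squnion> c y) y"
proof -
  show *: "join_defined m (c y)"
    using assms by (rule orthogonal_join)
  show "meet_defined (m \<squnion> c y) y"
    using join_in_U[OF *] by (auto simp: U_def intro: defined_above)
qed

end

end

theory Submission
  imports Defs
begin

text \<open>For a fixed \<open>y\<close>, the map \<open>a \<mapsto> a \<sqinter> y\<close> sends the elements above \<open>c y\<close> to elements below \<open>y\<close>,
  and \<open>b \<mapsto> b \<squnion> c y\<close> goes back; orthogonality says precisely that both maps are defined there.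
  The second is always left adjoint to the first, so \<open>a \<sqinter> y \<squnion> c y \<le> a\<close> for \<open>c y \<le> a\<close>, and
  \<open>b \<le> (b \<squnion> c y) \<sqinter> y\<close> for \<open>b \<le> y\<close>. (A1) and (A2) are set-valued forms of the two implications
  that would make it right adjoint as well. Conditions (iii) and (vi) ask for equality in these two
  inequalities, that is, for the opposite inequality \<open>a \<le> a \<sqinter> y \<squnion> c y\<close> or \<open>(b \<squnion> c y) \<sqinter> y \<le> b\<close>
  (\<open>meet_join_cancel\<close> and \<open>join_meet_cancel\<close>).

  The two cancellation laws imply every other condition. For the equations (i) and (iv) they are
  applied to each minimal upper bound of \<open>x\<close> and \<open>c y\<close>, which lies above \<open>c y\<close>, or to each maximal
  lower bound of \<open>x\<close> and \<open>y\<close>, which lies below \<open>x\<close>. For (A1) and (A2) saturation provides, in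
  addition, a maximal lower or minimal upper bound beyond a given bound, and monotonicity of the
  two maps does the rest.

  Conversely, if \<open>c y \<le> x\<close>, then \<open>x\<close> is the only minimal upper bound of \<open>x\<close> and \<open>c y\<close>
  (\<open>Minimals_U_comparable\<close>), and if \<open>y \<le> x\<close>, then \<open>y\<close> is the only maximal lower bound of \<open>x\<close> and
  \<open>y\<close> (\<open>Maximals_L_comparable\<close>). For such arguments every condition of the theorem is about
  single elements, and a suitable choice of them turns it into a cancellation law.\<close>

section \<open>Bounds, joins and meets\<close>

lemma Minimals_U_comparable:
  "b \<le> a \<Longrightarrow> Minimals (U a b) = {a}"
  by (auto simp: Minimals_def U_def)

lemma Maximals_L_comparable:
  "b \<le> a \<Longrightarrow> Maximals (L a b) = {b}"
  by (auto simp: Maximals_def L_def)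

lemma Minimals_U_upper:
  assumes "m \<in> Minimals (U x y)"
  shows "x \<le> m" and "y \<le> m"
  using assms by (auto simp: Minimals_def U_def)

lemma Maximals_L_lower:
  assumes "m \<in> Maximals (L x y)"
  shows "m \<le> x" and "m \<le> y"
  using assms by (auto simp: Maximals_def L_def)

lemma join_le_iff:
  assumes "join_defined x y"
  shows "x \<squnion> y \<le> z \<longleftrightarrow> x \<le> z \<and> y \<le> z"
proof -
  obtain s where s: "s \<in> U x y" "\<forall>t\<in>U x y. s \<le> t"
    using assms by (auto simp: join_defined_def)
  then have "x \<squnion> y = s"
    unfolding join_def by (intro Least_equality) auto
  with s show ?thesis
    by (auto simp: U_def)
qed

lemma le_meet_iff:
  assumes "meet_defined x y"
  shows "z \<le> x \<sqinter> y \<longleftrightarrow> z \<le> x \<and> z \<le> y"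
proof -
  obtain s where s: "s \<in> L x y" "\<forall>t\<in>L x y. t \<le> s"
    using assms by (auto simp: meet_defined_def)
  then have "x \<sqinter> y = s"
    unfolding meet_def by (intro Greatest_equality) auto
  with s show ?thesis
    by (auto simp: L_def)
qed

section \<open>The two cancellation laws\<close>

definition meet_join_cancel :: "('a::order \<Rightarrow> 'a) \<Rightarrow> bool" where
  "meet_join_cancel c \<longleftrightarrow> (\<forall>a y. c y \<le> a \<longrightarrow> a \<le> a \<sqinter> y \<squnion> c y)"

definition join_meet_cancel :: "('a::order \<Rightarrow> 'a) \<Rightarrow> bool" where
  "join_meet_cancel c \<longleftrightarrow> (\<forall>b y. b \<le> y \<longrightarrow> (b \<squnion> c y) \<sqinter> y \<le> b)"

context bounded_orthogonal_saturated_poset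
begin

lemma meet_lower:
  assumes "c y \<le> a"
  shows "a \<sqinter> y \<le> a" and "a \<sqinter> y \<le> y"
  using meet_in_L[OF defined_above(1)[OF assms]] by (auto simp: L_def)

lemma join_upper:
  assumes "b \<le> y"
  shows "b \<le> b \<squnion> c y" and "c y \<le> b \<squnion> c y"
  using join_in_U[OF defined_below(1)[OF assms]] by (auto simp: U_def)

lemma meet_mono:
  assumes "c y \<le> a" "a \<le> b"
  shows "a \<sqinter> y \<le> b \<sqinter> y"
proof -
  have "c y \<le> b"
    using assms by (rule order_trans)
  with assms(2) show ?thesis
    using meet_lower[OF assms(1)] by (auto simp: le_meet_iff[OF defined_above(1)])
qed

lemma join_mono:
  assumes "a \<le> b" "b \<le> y"
  shows "a \<squnion> c y \<le> b \<squnion> c y"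
proof -
  have "a \<le> y"
    using assms by (rule order_trans)
  with assms(1) show ?thesis
    using join_upper[OF assms(2)] by (auto simp: join_le_iff[OF defined_below(1)])
qed

text \<open>The inequalities opposite to the cancellation laws are unit and counit of the adjunction that
  always holds; they are what turns a cancellation law into an equation.\<close>

lemma meet_join_le:
  assumes "c y \<le> a"
  shows "a \<sqinter> y \<squnion> c y \<le> a"
  using assms meet_lower(1)[OF assms] by (simp add: join_le_iff[OF defined_above(2)])

lemma le_join_meet:
  assumes "b \<le> y"
  shows "b \<le> (b \<squnion> c y) \<sqinter> y"
  using assms join_upper(1)[OF assms] by (simp add: le_meet_iff[OF defined_below(2)])

lemma meet_join_eq:
  "meet_join_cancel c \<Longrightarrow> c y \<le> a \<Longrightarrow> a \<sqinter> y \<squnion> c y = a"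
  by (auto simp: meet_join_cancel_def intro: antisym meet_join_le)

lemma join_meet_eq:
  "join_meet_cancel c \<Longrightarrow> b \<le> y \<Longrightarrow> (b \<squnion> c y) \<sqinter> y = b"
  by (auto simp: join_meet_cancel_def intro: antisym le_join_meet)

section \<open>Conditions equivalent to (A1)\<close>

lemma meet_join_cancel_iff_equation:
  "meet_join_cancel c \<longleftrightarrow> (\<forall>x y. c x \<le> y \<longrightarrow> y = c x \<squnion> (y \<sqinter> x))"
proof
  assume "meet_join_cancel c"
  then show "\<forall>x y. c x \<le> y \<longrightarrow> y = c x \<squnion> (y \<sqinter> x)"
    by (simp add: join_commute[of "c _"] meet_join_eq)
next
  assume eq: "\<forall>x y. c x \<le> y \<longrightarrow> y = c x \<squnion> (y \<sqinter> x)"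
  show "meet_join_cancel c"
    unfolding meet_join_cancel_def
  proof (intro allI impI)
    fix a y
    assume "c y \<le> a"
    with eq have "a = a \<sqinter> y \<squnion> c y"
      by (metis join_commute)
    then show "a \<le> a \<sqinter> y \<squnion> c y"
      by (rule eq_refl)
  qed
qed

lemma Minimals_equation_if_meet_join_cancel:
  assumes "meet_join_cancel c"
  shows "(Minimals (U x (c y)) \<sqinter>\<^sub>S y) \<squnion>\<^sub>S c y = Minimals (U x (c y))"
proof -
  have "m \<sqinter> y \<squnion> c y = m" if "m \<in> Minimals (U x (c y))" for m
    using meet_join_eq[OF assms Minimals_U_upper(2)[OF that]] .
  moreover have "(Minimals (U x (c y)) \<sqinter>\<^sub>S y) \<squnion>\<^sub>S c y = (\<lambda>m. m \<sqinter> y \<squnion> c y) ` Minimals (U x (c y))"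
    by (auto simp: set_meet_def set_join_def)
  ultimately show ?thesis
    by simp
qed

text \<open>For \<open>c y \<le> a\<close>, the minimal upper bounds of \<open>a\<close> and \<open>c y\<close> reduce to \<open>a\<close>.\<close>

lemma meet_join_cancel_if_le2:
  assumes "\<forall>x y. Minimals (U x (c y)) \<le>\<^sub>2 (Minimals (U x (c y)) \<sqinter>\<^sub>S y) \<squnion>\<^sub>S c y"
  shows "meet_join_cancel c"
  unfolding meet_join_cancel_def
proof (intro allI impI)
  fix a y
  assume "c y \<le> a"
  then show "a \<le> a \<sqinter> y \<squnion> c y"
    using assms[rule_format, of a y]
    by (simp add: Minimals_U_comparable le2_def set_join_def set_meet_def)
qed

lemma A1_if_meet_join_cancel:
  assumes "meet_join_cancel c"
  shows "A1 c"
  unfolding A1_def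
proof (intro allI impI)
  fix x y z
  assume "sasaki_odot c x y \<le>\<^sub>2 {z}"
  then obtain m where m: "m \<in> Minimals (U x (c y))" "m \<sqinter> y \<le> z"
    by (auto simp: sasaki_odot_def le2_def set_meet_def)
  have "c y \<le> m"
    using m(1) by (rule Minimals_U_upper)
  then have "m \<sqinter> y \<in> L y z"
    using m(2) meet_lower(2) by (auto simp: L_def)
  then obtain k where k: "k \<in> Maximals (L y z)" "m \<sqinter> y \<le> k"
    using saturated_L by blast
  have "x \<le> m"
    using m(1) by (rule Minimals_U_upper)
  also have "m = m \<sqinter> y \<squnion> c y"
    using meet_join_eq[OF assms \<open>c y \<le> m\<close>] by simp
  also have "\<dots> \<le> k \<squnion> c y"
    using k(2) Maximals_L_lower(1)[OF k(1)] by (rule join_mono)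
  finally show "{x} \<le>\<^sub>1 sasaki_imp c y z"
    using k(1) by (auto simp: sasaki_imp_def le1_def set_join_def)
qed

text \<open>For \<open>c y \<le> a\<close> the set \<open>sasaki_odot c a y\<close> is \<open>{a \<sqinter> y}\<close>, so (A1) applies with \<open>z = a \<sqinter> y\<close>;
  as \<open>z \<le> y\<close>, its conclusion is the cancellation law.\<close>

lemma meet_join_cancel_if_A1:
  assumes "A1 c"
  shows "meet_join_cancel c"
  unfolding meet_join_cancel_def
proof (intro allI impI)
  fix a y
  assume above: "c y \<le> a"
  then have "sasaki_odot c a y \<le>\<^sub>2 {a \<sqinter> y}"
    by (simp add: sasaki_odot_def Minimals_U_comparable le2_def set_meet_def)
  then have "{a} \<le>\<^sub>1 sasaki_imp c y (a \<sqinter> y)"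
    using assms by (simp add: A1_def)
  then show "a \<le> a \<sqinter> y \<squnion> c y"
    using meet_lower(2)[OF above]
    by (simp add: sasaki_imp_def Maximals_L_comparable le1_def set_join_def)
qed

section \<open>Conditions equivalent to (A2)\<close>

lemma join_meet_cancel_iff_equation:
  "join_meet_cancel c \<longleftrightarrow> (\<forall>x y. x \<le> y \<longrightarrow> x = (c y \<squnion> x) \<sqinter> y)"
proof
  assume "join_meet_cancel c"
  then show "\<forall>x y. x \<le> y \<longrightarrow> x = (c y \<squnion> x) \<sqinter> y"
    by (simp add: join_commute[of "c _"] join_meet_eq)
next
  assume eq: "\<forall>x y. x \<le> y \<longrightarrow> x = (c y \<squnion> x) \<sqinter> y"
  show "join_meet_cancel c"
    unfolding join_meet_cancel_def
  proof (intro allI impI)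
    fix b y :: 'a
    assume "b \<le> y"
    with eq have "(b \<squnion> c y) \<sqinter> y = b"
      by (metis join_commute)
    then show "(b \<squnion> c y) \<sqinter> y \<le> b"
      by (rule eq_refl)
  qed
qed

lemma Maximals_equation_if_join_meet_cancel:
  assumes "join_meet_cancel c"
  shows "(Maximals (L x y) \<squnion>\<^sub>S c x) \<sqinter>\<^sub>S x = Maximals (L x y)"
proof -
  have "(m \<squnion> c x) \<sqinter> x = m" if "m \<in> Maximals (L x y)" for m
    using join_meet_eq[OF assms Maximals_L_lower(1)[OF that]] .
  moreover have "(Maximals (L x y) \<squnion>\<^sub>S c x) \<sqinter>\<^sub>S x = (\<lambda>m. (m \<squnion> c x) \<sqinter> x) ` Maximals (L x y)"
    by (auto simp: set_meet_def set_join_def)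
  ultimately show ?thesis
    by simp
qed

text \<open>For \<open>b \<le> y\<close>, the maximal lower bounds of \<open>y\<close> and \<open>b\<close> reduce to \<open>b\<close>.\<close>

lemma join_meet_cancel_if_le1:
  assumes "\<forall>x y. (Maximals (L x y) \<squnion>\<^sub>S c x) \<sqinter>\<^sub>S x \<le>\<^sub>1 Maximals (L x y)"
  shows "join_meet_cancel c"
  unfolding join_meet_cancel_def
proof (intro allI impI)
  fix b y :: 'a
  assume "b \<le> y"
  then show "(b \<squnion> c y) \<sqinter> y \<le> b"
    using assms[rule_format, of y b]
    by (simp add: Maximals_L_comparable le1_def set_join_def set_meet_def)
qed

lemma A2_if_join_meet_cancel:
  assumes "join_meet_cancel c"
  shows "A2 c"
  unfolding A2_def
proof (intro allI impI)
  fix x y z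
  assume "{x} \<le>\<^sub>1 sasaki_imp c y z"
  then obtain k where k: "k \<in> Maximals (L y z)" "x \<le> k \<squnion> c y"
    by (auto simp: sasaki_imp_def le1_def set_join_def)
  have "k \<le> y"
    using k(1) by (rule Maximals_L_lower)
  then have "k \<squnion> c y \<in> U x (c y)"
    using k(2) join_upper(2) by (auto simp: U_def)
  then obtain m where m: "m \<in> Minimals (U x (c y))" "m \<le> k \<squnion> c y"
    using saturated_U by blast
  have "m \<sqinter> y \<le> (k \<squnion> c y) \<sqinter> y"
    using Minimals_U_upper(2)[OF m(1)] m(2) by (rule meet_mono)
  also have "\<dots> = k"
    using assms \<open>k \<le> y\<close> by (rule join_meet_eq)
  also have "k \<le> z"
    using k(1) by (rule Maximals_L_lower)
  finally show "sasaki_odot c x y \<le>\<^sub>2 {z}"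
    using m(1) by (auto simp: sasaki_odot_def le2_def set_meet_def)
qed

text \<open>For \<open>b \<le> y\<close> the set \<open>sasaki_imp c y b\<close> is \<open>{b \<squnion> c y}\<close>, so (A2) applies with \<open>x = b \<squnion> c y\<close>
  and \<open>z = b\<close>; as \<open>c y \<le> x\<close>, its conclusion is the cancellation law.\<close>

lemma join_meet_cancel_if_A2:
  assumes "A2 c"
  shows "join_meet_cancel c"
  unfolding join_meet_cancel_def
proof (intro allI impI)
  fix b y :: 'a
  assume below: "b \<le> y"
  then have "{b \<squnion> c y} \<le>\<^sub>1 sasaki_imp c y b"
    by (simp add: sasaki_imp_def Maximals_L_comparable le1_def set_join_def)
  then have "sasaki_odot c (b \<squnion> c y) y \<le>\<^sub>2 {b}"
    using assms by (simp add: A2_def)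
  then show "(b \<squnion> c y) \<sqinter> y \<le> b"
    using join_upper(2)[OF below]
    by (simp add: sasaki_odot_def Minimals_U_comparable le2_def set_meet_def)
qed

end

section \<open>Characterizations of the two adjointness conditions\<close>

lemma le1_refl: "A \<le>\<^sub>1 A"
  by (auto simp: le1_def)

lemma le2_refl: "A \<le>\<^sub>2 A"
  by (auto simp: le2_def)

theorem theorem4p2:
  fixes c :: "'a::{order_bot, order_top} \<Rightarrow> 'a"
  assumes "bounded_orthogonal_saturated_poset c"
  shows
    "(A1 c \<longleftrightarrow>
        (\<forall>x y. Minimals (U x (c y)) = (Minimals (U x (c y)) \<sqinter>\<^sub>S y) \<squnion>\<^sub>S c y)) \<and>
     (A1 c \<longleftrightarrow>
        (\<forall>x y. Minimals (U x (c y)) \<le>\<^sub>2 (Minimals (U x (c y)) \<sqinter>\<^sub>S y) \<squnion>\<^sub>S c y)) \<and>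
     (A1 c \<longleftrightarrow>
        (\<forall>x y. c x \<le> y \<longrightarrow> y = c x \<squnion> (y \<sqinter> x))) \<and>
     (A2 c \<longleftrightarrow>
        (\<forall>x y. (Maximals (L x y) \<squnion>\<^sub>S c x) \<sqinter>\<^sub>S x = Maximals (L x y))) \<and>
     (A2 c \<longleftrightarrow>
        (\<forall>x y. (Maximals (L x y) \<squnion>\<^sub>S c x) \<sqinter>\<^sub>S x \<le>\<^sub>1 Maximals (L x y))) \<and>
     (A2 c \<longleftrightarrow>
        (\<forall>x y. x \<le> y \<longrightarrow> x = (c y \<squnion> x) \<sqinter> y))"
proof -
  interpret bounded_orthogonal_saturated_poset c
    by (rule assms)
  let ?i = "\<forall>x y. Minimals (U x (c y)) = (Minimals (U x (c y)) \<sqinter>\<^sub>S y) \<squnion>\<^sub>S c y"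
  let ?ii = "\<forall>x y. Minimals (U x (c y)) \<le>\<^sub>2 (Minimals (U x (c y)) \<sqinter>\<^sub>S y) \<squnion>\<^sub>S c y"
  let ?iv = "\<forall>x y. (Maximals (L x y) \<squnion>\<^sub>S c x) \<sqinter>\<^sub>S x = Maximals (L x y)"
  let ?v = "\<forall>x y. (Maximals (L x y) \<squnion>\<^sub>S c x) \<sqinter>\<^sub>S x \<le>\<^sub>1 Maximals (L x y)"
  have A1: "A1 c \<longleftrightarrow> meet_join_cancel c"
    using A1_if_meet_join_cancel meet_join_cancel_if_A1 by blast
  have i: "meet_join_cancel c \<Longrightarrow> ?i"
    by (simp add: Minimals_equation_if_meet_join_cancel)
  have i_ii: "?i \<Longrightarrow> ?ii"
    using le2_refl by metis
  have ii: "?ii \<Longrightarrow> meet_join_cancel c"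
    by (rule meet_join_cancel_if_le2)
  have A2: "A2 c \<longleftrightarrow> join_meet_cancel c"
    using A2_if_join_meet_cancel join_meet_cancel_if_A2 by blast
  have iv: "join_meet_cancel c \<Longrightarrow> ?iv"
    by (simp add: Maximals_equation_if_join_meet_cancel)
  have iv_v: "?iv \<Longrightarrow> ?v"
    by (simp add: le1_refl)
  have v: "?v \<Longrightarrow> join_meet_cancel c"
    by (rule join_meet_cancel_if_le1)
  show ?thesis
    unfolding A1 A2 meet_join_cancel_iff_equation[symmetric] join_meet_cancel_iff_equation[symmetric]
    using i i_ii ii iv iv_v v by argo
qed

end
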